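(* Consider a two-dimensional coin consisting of two equal point masses $m_L$ and $m_R$ connected by a weightless rigid rod of length $l>0$ in the $XY$ plane. Suppose the coin moves in $Y>0$ under the influence of gravity $g>0$ and makes elastic collisions at $Y=0$. Label a collision of the mass $m_L$ with the floor $Y=0$ by $L$ and a collision of the mass $m_R$ with the floor by $R$. Then every infinite collision sequence of $L$'s and $R$'s can be realized by choosing an appropriate initial condition: for every bi-infinite sequence $(c_i)_{i\in\mathbb{Z}}\in\{L,R\}^{\mathbb{Z}}$ there is a motion of the coin whose consecutive collisions with the floor can be indexed by $i\in\mathbb{Z}$ in order of time so that, for every $i$, the $i$-th collision has label $c_i$.
   Context: The coin. Let $m=m_L+m_R$ (with $m_L=m_R$) and let $I=\frac14 m l^2$ be the moment of inertia. Let $(X,Y)$ be the center of mass and let $\theta\in\mathbb{R}$ be the angle of the normal vector of the coin measured counterclockwise from the positive $Y$-direction. The heights of the two masses are $Y_L=Y-\frac l2\sin\theta$ and $Y_R=Y+\frac l2\sin\theta$, both required to be $\ge 0$. The horizontal velocity of the center of mass is constant, so one assumes the center of mass does not move in the $X$-direction, and the configuration of the coin is $(\theta,Y)$. A collision of $m_L$ (respectively $m_R$) is a time at which $Y_L=0$ (respectively $Y_R=0$). Dynamics. Put $Y=\sqrt{I/m}\,y=\frac l2 y$. In the coordinates $(\theta,y)$ the coin is a point moving in the domain $\mathcal{Q}=\{(\theta,y): y\ge|\sin\theta|\}$. The energy is $E=\frac{I\dot\theta^2}{2}+\frac{I\dot y^2}{2}+g\sqrt{mI}\,y$, and between collisions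 $\ddot\theta=0$ and $\ddot y=-g\sqrt{m/I}$. At a boundary point $y=|\sin\theta|$ with $\theta\notin\pi\mathbb{Z}$ the velocity $(\dot\theta,\dot y)$ undergoes the mirror reflection law $$\begin{pmatrix}\dot\theta_+\\ \dot y_+\end{pmatrix}=\frac{1}{1+\cos^2\theta}\begin{pmatrix}\sin^2\theta & 2\cos\theta\,\frac{\sin\theta}{|\sin\theta|}\\ 2\cos\theta\,\frac{\sin\theta}{|\sin\theta|} & -\sin^2\theta\end{pmatrix}\begin{pmatrix}\dot\theta_-\\ \dot y_-\end{pmatrix},$$ where the subscripts $-$ and $+$ denote values right before and right after the collision. Collisions of $m_L$ are boundary hits with $\theta\in(2n\pi,(2n+1)\pi)$ for some $n\in\mathbb{Z}$; collisions of $m_R$ are boundary hits with $\theta\in((2n-1)\pi,2n\pi)$ for some $n\in\mathbb{Z}$. *)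

theory Defs
  imports "HOL-Analysis.Analysis"
begin

datatype side = L | R

definition coin_inertia :: "real \<Rightarrow> real \<Rightarrow> real \<Rightarrow> real" where
  "coin_inertia mL mR l = 1/4 * (mL + mR) * l^2"

definition coin_height :: "real \<Rightarrow> side \<Rightarrow> real \<Rightarrow> real \<Rightarrow> real" where
  "coin_height l a \<theta> Y = (case a of L \<Rightarrow> Y - l/2 * sin \<theta> | R \<Rightarrow> Y + l/2 * sin \<theta>)"

definition collision_times :: "real \<Rightarrow> (real \<Rightarrow> real) \<Rightarrow> (real \<Rightarrow> real) \<Rightarrow> real set" where
  "collision_times l \<theta> Y = {t. \<exists>a. coin_height l a (\<theta> t) (Y t) = 0}"

text \<open>The angular ranges exclude the simultaneous collision of both masses, where
  \<open>\<theta>\<close> is a multiple of \<open>\<pi>\<close>; such a collision carries no label.\<close>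

definition collision_label :: "real \<Rightarrow> (real \<Rightarrow> real) \<Rightarrow> (real \<Rightarrow> real) \<Rightarrow> real \<Rightarrow> side \<Rightarrow> bool" where
  "collision_label l \<theta> Y t a \<longleftrightarrow>
     coin_height l a (\<theta> t) (Y t) = 0 \<and>
     (\<exists>n::int. case a of
        L \<Rightarrow> 2 * of_int n * pi < \<theta> t \<and> \<theta> t < (2 * of_int n + 1) * pi
      | R \<Rightarrow> (2 * of_int n - 1) * pi < \<theta> t \<and> \<theta> t < 2 * of_int n * pi)"

text \<open>Mirror reflection of a velocity at the boundary \<open>y = \<bar>sin \<theta>\<bar>\<close> of the domain
  \<open>y \<ge> \<bar>sin \<theta>\<bar>\<close>, in the coordinates \<open>(\<theta>, y)\<close> in which the kinetic energy is a multiple of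
  the Euclidean one.\<close>

definition coin_reflect :: "real \<Rightarrow> real \<times> real \<Rightarrow> real \<times> real" where
  "coin_reflect \<theta> = (\<lambda>(u, v).
     (1 / (1 + (cos \<theta>)^2) * ((sin \<theta>)^2 * u + 2 * cos \<theta> * (sin \<theta> / \<bar>sin \<theta>\<bar>) * v),
      1 / (1 + (cos \<theta>)^2) * (2 * cos \<theta> * (sin \<theta> / \<bar>sin \<theta>\<bar>) * u - (sin \<theta>)^2 * v)))"

text \<open>A motion for all times, with \<open>\<theta>\<close> the (lifted) angle and \<open>Y\<close> the height of the center of
  mass; \<open>y\<close> is the rescaled height, \<open>Y = sqrt (I/m) * y\<close>. The velocities right before and right
  after a collision are the one-sided derivatives. No law is imposed at a simultaneous collision
  of both masses.\<close>

definition coin_motion ::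
  "real \<Rightarrow> real \<Rightarrow> real \<Rightarrow> real \<Rightarrow> (real \<Rightarrow> real) \<Rightarrow> (real \<Rightarrow> real) \<Rightarrow> bool" where
  "coin_motion mL mR l g \<theta> Y \<longleftrightarrow>
     (let m = mL + mR; I = coin_inertia mL mR l; y = (\<lambda>t. Y t / sqrt (I / m)) in
        continuous_on UNIV \<theta> \<and> continuous_on UNIV Y \<and>
        (\<forall>t a. coin_height l a (\<theta> t) (Y t) \<ge> 0) \<and>
        (\<forall>t. t \<notin> collision_times l \<theta> Y \<longrightarrow>
           \<theta> differentiable (at t) \<and> y differentiable (at t) \<and>
           (deriv \<theta> has_real_derivative 0) (at t) \<and>
           (deriv y has_real_derivative - g * sqrt (m / I)) (at t)) \<and>
        (\<forall>t. t \<in> collision_times l \<theta> Y \<and> \<theta> t \<notin> range (\<lambda>n::int. of_int n * pi) \<longrightarrow>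
           (\<exists>u v u' v'.
              (\<theta> has_real_derivative u) (at_left t) \<and> (y has_real_derivative v) (at_left t) \<and>
              (\<theta> has_real_derivative u') (at_right t) \<and> (y has_real_derivative v') (at_right t) \<and>
              (u', v') = coin_reflect (\<theta> t) (u, v))))"

end

theory Submission
  imports Defs
begin

text \<open>At high energy the coin bounces almost vertically. All collisions are placed near the two tips
\<open>\<theta> = \<pi>/2\<close> (label \<open>L\<close>) and \<open>\<theta> = - \<pi>/2\<close> (label \<open>R\<close>) of the bumps of the floor
\<open>y = \<bar>sin \<theta>\<bar>\<close>, at angles \<open>\<theta>\<^sub>i = \<plusminus>\<pi>/2 + \<phi>\<^sub>i\<close> with \<open>\<bar>\<phi>\<^sub>i\<bar> \<le> 1/2\<close> and the
sign prescribed by the label. For a fixed large energy any two such points are joined by exactly one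
high parabola. Two consecutive parabolas therefore have the same speed at their common end point, and
they are related by the reflection law as soon as the jump of the velocity is normal to the floor.
This gives one scalar equation for each collision, \<open>sin \<phi>\<^sub>i = N\<^sub>i / W\<^sub>i\<close>, where \<open>N\<^sub>i\<close>
and \<open>W\<^sub>i\<close> are the horizontal and the vertical jump of the velocity.

A flight takes a long time \<open>r\<close>, so horizontal velocities have size \<open>1/r\<close>, whereas vertical ones
have size \<open>r\<close>. Hence \<open>N\<^sub>i / W\<^sub>i\<close> is small, and so is its Lipschitz constant with respect
to the angles; in the limit of infinite energy the equations decouple into \<open>sin \<phi>\<^sub>i = 0\<close>. So
\<open>\<phi> \<mapsto> \<phi> - sin \<phi> + N/W\<close> is a contraction of the ball of radius \<open>1/2\<close> in the space of
bounded bi-infinite sequences, for every sequence of labels, and its fixed point is the required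
sequence of collision angles (\<open>balanced_angles_exist\<close>).

It remains to glue the parabolas to a motion. Long flights leave the floor steeply, so that they do
not touch it in between (\<open>flight_clearance\<close>); flight times are bounded below, so that the flights
cover the whole time axis (\<open>partition_of_line_exists\<close>). Everything up to this point is computed
for unit gravity; the actual gravity only changes the unit of time.\<close>

section \<open>Parabolas of fixed energy between two points of the floor\<close>

definition chord_sq :: "real \<Rightarrow> real \<Rightarrow> real" where
  "chord_sq \<alpha> \<beta> = (\<beta> - \<alpha>)\<^sup>2 + (\<bar>sin \<beta>\<bar> - \<bar>sin \<alpha>\<bar>)\<^sup>2"

text \<open>The mean of the kinetic energies at the two ends of a flight of total energy \<open>2501\<close>. This energy
makes the mean at least \<open>2500\<close>, hence the flight time at least \<open>sqrt (4 * 2500) = 100\<close>.\<close>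

definition kinetic_mean :: "real \<Rightarrow> real \<Rightarrow> real" where
  "kinetic_mean \<alpha> \<beta> = 2501 - (\<bar>sin \<alpha>\<bar> + \<bar>sin \<beta>\<bar>) / 2"

text \<open>A flight of duration \<open>r\<close> has energy balance
\<open>r\<^sup>2 / 8 + chord_sq \<alpha> \<beta> / (2 r\<^sup>2) = kinetic_mean \<alpha> \<beta>\<close>, a quadratic equation for \<open>r\<^sup>2\<close>.
The larger root belongs to the high one of the two parabolas through the end points.\<close>

definition flight_time :: "real \<Rightarrow> real \<Rightarrow> real" where
  "flight_time \<alpha> \<beta> =
     sqrt (4 * (kinetic_mean \<alpha> \<beta> + sqrt ((kinetic_mean \<alpha> \<beta>)\<^sup>2 - chord_sq \<alpha> \<beta> / 4)))"

text \<open>\<open>(launch_u \<alpha> \<beta>, launch_v \<alpha> \<beta>)\<close> is the velocity with which the high parabola to \<open>\<beta>\<close>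
leaves the floor at \<open>\<alpha>\<close>. By time reversal, the velocity on arrival at \<open>\<alpha>\<close> from \<open>\<beta>\<close> is its
negative.\<close>

definition launch_u :: "real \<Rightarrow> real \<Rightarrow> real" where
  "launch_u \<alpha> \<beta> = (\<beta> - \<alpha>) / flight_time \<alpha> \<beta>"

definition launch_v :: "real \<Rightarrow> real \<Rightarrow> real" where
  "launch_v \<alpha> \<beta> = (\<bar>sin \<beta>\<bar> - \<bar>sin \<alpha>\<bar>) / flight_time \<alpha> \<beta> + flight_time \<alpha> \<beta> / 2"

lemma abs_sin_lipschitz: "\<bar>\<bar>sin \<beta>\<bar> - \<bar>sin \<alpha>\<bar>\<bar> \<le> \<bar>\<beta> - \<alpha>\<bar>" for \<alpha> \<beta> :: real
proof -
  have "\<bar>sin \<beta> - sin \<alpha>\<bar> = 2 * \<bar>sin ((\<beta> - \<alpha>) / 2)\<bar> * \<bar>cos ((\<beta> + \<alpha>) / 2)\<bar>"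
    by (simp add: sin_diff_sin abs_mult)
  also have "\<dots> \<le> 2 * \<bar>(\<beta> - \<alpha>) / 2\<bar> * 1"
    by (intro mult_mono abs_sin_x_le_abs_x abs_cos_le_one) auto
  finally show ?thesis using abs_triangle_ineq3[of "sin \<beta>" "sin \<alpha>"] by simp
qed

lemma quotient_diff_le:
  fixes a b a' b' :: real
  assumes "0 < m" "m \<le> b" "m \<le> b'" "\<bar>a'\<bar> \<le> k"
  shows "\<bar>a / b - a' / b'\<bar> \<le> (\<bar>a - a'\<bar> + k / m * \<bar>b - b'\<bar>) / m"
proof -
  have pos: "b > 0" "b' > 0" "k \<ge> 0" using assms by auto
  have "a / b - a' / b' = (a - a') / b + (a' / b') * (b' - b) / b"
    using pos by (simp add: field_simps)
  also have "\<bar>\<dots>\<bar> \<le> \<bar>a - a'\<bar> / b + (\<bar>a'\<bar> / b') * \<bar>b - b'\<bar> / b"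
    using abs_triangle_ineq[of "(a - a') / b" "(a' / b') * (b' - b) / b"] pos
    by (simp add: abs_mult abs_divide abs_minus_commute)
  also have "\<dots> = (\<bar>a - a'\<bar> + (\<bar>a'\<bar> / b') * \<bar>b - b'\<bar>) / b" by (simp add: add_divide_distrib)
  also have "\<dots> \<le> (\<bar>a - a'\<bar> + k / m * \<bar>b - b'\<bar>) / m"
    using assms pos by (intro frac_le add_mono mult_right_mono) auto
  finally show ?thesis .
qed

lemma chord_sq_bounds:
  assumes "\<bar>\<beta> - \<alpha>\<bar> \<le> 5"
  shows "0 \<le> chord_sq \<alpha> \<beta>" "chord_sq \<alpha> \<beta> \<le> 50"
proof -
  have "(\<beta> - \<alpha>)\<^sup>2 \<le> 5\<^sup>2" "(\<bar>sin \<beta>\<bar> - \<bar>sin \<alpha>\<bar>)\<^sup>2 \<le> 5\<^sup>2"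
    using assms abs_sin_lipschitz[of \<beta> \<alpha>] unfolding abs_le_square_iff[symmetric] by simp_all
  then show "chord_sq \<alpha> \<beta> \<le> 50" by (simp add: chord_sq_def)
  show "0 \<le> chord_sq \<alpha> \<beta>" by (simp add: chord_sq_def)
qed

lemma kinetic_mean_ge: "2500 \<le> kinetic_mean \<alpha> \<beta>"
  using abs_sin_le_one[of \<alpha>] abs_sin_le_one[of \<beta>] unfolding kinetic_mean_def by argo

lemma flight_time:
  assumes "\<bar>\<beta> - \<alpha>\<bar> \<le> 5"
  shows flight_time_ge: "100 \<le> flight_time \<alpha> \<beta>"
    and flight_time_root:
      "(flight_time \<alpha> \<beta>)\<^sup>2 = 8 * kinetic_mean \<alpha> \<beta> - 4 * (chord_sq \<alpha> \<beta> / (flight_time \<alpha> \<beta>)\<^sup>2)"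
proof -
  define K where "K = kinetic_mean \<alpha> \<beta>"
  define D where "D = chord_sq \<alpha> \<beta>"
  define S where "S = sqrt (K\<^sup>2 - D / 4)"
  have K: "2500 \<le> K" unfolding K_def by (rule kinetic_mean_ge)
  have "2500\<^sup>2 \<le> K\<^sup>2" using K by (intro power_mono) auto
  then have disc: "0 \<le> K\<^sup>2 - D / 4"
    using chord_sq_bounds[OF assms] by (simp add: D_def)
  have S: "0 \<le> S" "S\<^sup>2 = K\<^sup>2 - D / 4" using disc by (auto simp: S_def)
  have q: "(flight_time \<alpha> \<beta>)\<^sup>2 = 4 * (K + S)"
    using K S by (simp add: flight_time_def S_def K_def D_def)
  have "100 = sqrt (4 * 2500)" by (simp add: real_sqrt_mult)
  also have "\<dots> \<le> flight_time \<alpha> \<beta>"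
    unfolding flight_time_def K_def[symmetric] D_def[symmetric] S_def[symmetric] using K S(1)
    by (intro real_sqrt_le_mono) simp
  finally show "100 \<le> flight_time \<alpha> \<beta>" .
  have "4 * (K + S) * (4 * (K + S)) = 8 * K * (4 * (K + S)) - 4 * D"
    using S(2) by (simp add: algebra_simps power2_eq_square)
  then have "4 * (K + S) = 8 * K - 4 * (D / (4 * (K + S)))"
    using K S(1) by (simp add: field_simps)
  then show "(flight_time \<alpha> \<beta>)\<^sup>2 = 8 * kinetic_mean \<alpha> \<beta> - 4 * (chord_sq \<alpha> \<beta> / (flight_time \<alpha> \<beta>)\<^sup>2)"
    unfolding q by (simp add: K_def D_def)
qed

lemma flight_time_commute: "flight_time \<beta> \<alpha> = flight_time \<alpha> \<beta>"
  by (simp add: flight_time_def kinetic_mean_def chord_sq_def power2_commute add.commute)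

text \<open>Conservation of energy during a flight. The point of the formula is that its right-hand side does
not involve \<open>\<beta>\<close>: all flights that start or end at \<open>\<alpha>\<close> have the same speed there.\<close>

lemma launch_energy:
  assumes "\<bar>\<beta> - \<alpha>\<bar> \<le> 5"
  shows "(launch_u \<alpha> \<beta>)\<^sup>2 + (launch_v \<alpha> \<beta>)\<^sup>2 = 2 * (2501 - \<bar>sin \<alpha>\<bar>)"
proof -
  define r where "r = flight_time \<alpha> \<beta>"
  have r: "r > 0" using flight_time_ge[OF assms] by (simp add: r_def)
  have "(launch_u \<alpha> \<beta>)\<^sup>2 + (launch_v \<alpha> \<beta>)\<^sup>2
      = chord_sq \<alpha> \<beta> / r\<^sup>2 + (\<bar>sin \<beta>\<bar> - \<bar>sin \<alpha>\<bar>) + r\<^sup>2 / 4"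
    using r unfolding launch_u_def launch_v_def chord_sq_def r_def[symmetric]
    by (simp add: power_divide power2_sum add_divide_distrib)
  also have "\<dots> = 2 * kinetic_mean \<alpha> \<beta> + (\<bar>sin \<beta>\<bar> - \<bar>sin \<alpha>\<bar>)"
    using flight_time_root[OF assms] by (simp add: r_def)
  also have "\<dots> = 2 * (2501 - \<bar>sin \<alpha>\<bar>)" unfolding kinetic_mean_def by argo
  finally show ?thesis .
qed

lemma launch_bounds:
  assumes "\<bar>\<beta> - \<alpha>\<bar> \<le> 5"
  shows "\<bar>launch_u \<alpha> \<beta>\<bar> \<le> 1 / 20" and "49 \<le> launch_v \<alpha> \<beta>"
proof -
  note r = flight_time_ge[OF assms]
  have quot: "\<bar>x / flight_time \<alpha> \<beta>\<bar> \<le> 1 / 20" if "\<bar>x\<bar> \<le> 5" for x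
    using frac_le[of 5 "\<bar>x\<bar>" 100 "flight_time \<alpha> \<beta>"] that r by (simp add: abs_divide)
  show "\<bar>launch_u \<alpha> \<beta>\<bar> \<le> 1 / 20" unfolding launch_u_def using assms by (rule quot)
  have "\<bar>(\<bar>sin \<beta>\<bar> - \<bar>sin \<alpha>\<bar>) / flight_time \<alpha> \<beta>\<bar> \<le> 1 / 20"
    using assms abs_sin_lipschitz[of \<beta> \<alpha>] by (intro quot) linarith
  then show "49 \<le> launch_v \<alpha> \<beta>" unfolding launch_v_def using r by argo
qed

lemma square_diff_le:
  fixes x x' :: real
  assumes "\<bar>x\<bar> \<le> 5" "\<bar>x'\<bar> \<le> 5" "\<bar>x - x'\<bar> \<le> d"
  shows "\<bar>x\<^sup>2 - x'\<^sup>2\<bar> \<le> 10 * d"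
proof -
  have "\<bar>x\<^sup>2 - x'\<^sup>2\<bar> = \<bar>x + x'\<bar> * \<bar>x - x'\<bar>"
    by (simp add: abs_mult[symmetric] power2_eq_square algebra_simps)
  also have "\<dots> \<le> 10 * d" using assms by (intro mult_mono) auto
  finally show ?thesis .
qed

text \<open>The squared flight time solves \<open>q = 8 K - 4 D / q\<close> with \<open>q \<ge> 10000\<close> and \<open>D \<le> 50\<close>. The
perturbation \<open>4 D / q\<close> depends on \<open>q\<close> so weakly that the difference of two solutions can be
absorbed on the left; what remains is about \<open>8\<close> times the variation of \<open>K\<close>.\<close>

lemma flight_time_lipschitz:
  assumes "\<bar>\<beta> - \<alpha>\<bar> \<le> 5" "\<bar>\<beta>' - \<alpha>'\<bar> \<le> 5" "\<bar>\<alpha> - \<alpha>'\<bar> \<le> \<delta>" "\<bar>\<beta> - \<beta>'\<bar> \<le> \<delta>"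
  shows "\<bar>flight_time \<alpha> \<beta> - flight_time \<alpha>' \<beta>'\<bar> \<le> \<delta> / 20"
proof -
  define r where "r = flight_time \<alpha> \<beta>"
  define r' where "r' = flight_time \<alpha>' \<beta>'"
  have r: "100 \<le> r" "100 \<le> r'" using assms flight_time_ge by (simp_all add: r_def r'_def)
  have q: "10000 \<le> r\<^sup>2" "10000 \<le> r'\<^sup>2"
    using r power_mono[of 100 r 2] power_mono[of 100 r' 2] by simp_all
  have sin_lip: "\<bar>\<bar>sin \<alpha>\<bar> - \<bar>sin \<alpha>'\<bar>\<bar> \<le> \<delta>" "\<bar>\<bar>sin \<beta>\<bar> - \<bar>sin \<beta>'\<bar>\<bar> \<le> \<delta>"
    using abs_sin_lipschitz[of \<alpha> \<alpha>'] abs_sin_lipschitz[of \<beta> \<beta>'] assms by linarith+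
  have sin5: "\<bar>\<bar>sin \<beta>\<bar> - \<bar>sin \<alpha>\<bar>\<bar> \<le> 5" "\<bar>\<bar>sin \<beta>'\<bar> - \<bar>sin \<alpha>'\<bar>\<bar> \<le> 5"
    using abs_sin_lipschitz[of \<beta> \<alpha>] abs_sin_lipschitz[of \<beta>' \<alpha>'] assms by linarith+
  have K: "\<bar>kinetic_mean \<alpha> \<beta> - kinetic_mean \<alpha>' \<beta>'\<bar> \<le> \<delta>"
    using sin_lip unfolding kinetic_mean_def by argo
  have "\<bar>(\<beta> - \<alpha>)\<^sup>2 - (\<beta>' - \<alpha>')\<^sup>2\<bar> \<le> 10 * (2 * \<delta>)"
    using assms by (intro square_diff_le) auto
  moreover have "\<bar>(\<bar>sin \<beta>\<bar> - \<bar>sin \<alpha>\<bar>)\<^sup>2 - (\<bar>sin \<beta>'\<bar> - \<bar>sin \<alpha>'\<bar>)\<^sup>2\<bar> \<le> 10 * (2 * \<delta>)"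
    using sin_lip by (intro square_diff_le[OF sin5]) argo
  ultimately have D: "\<bar>chord_sq \<alpha> \<beta> - chord_sq \<alpha>' \<beta>'\<bar> \<le> 40 * \<delta>"
    unfolding chord_sq_def by argo
  have "\<bar>chord_sq \<alpha> \<beta> / r\<^sup>2 - chord_sq \<alpha>' \<beta>' / r'\<^sup>2\<bar>
      \<le> (\<bar>chord_sq \<alpha> \<beta> - chord_sq \<alpha>' \<beta>'\<bar> + 50 / 10000 * \<bar>r\<^sup>2 - r'\<^sup>2\<bar>) / 10000"
    using q chord_sq_bounds[OF assms(2)] by (intro quotient_diff_le) auto
  then have quot: "\<bar>chord_sq \<alpha> \<beta> / r\<^sup>2 - chord_sq \<alpha>' \<beta>' / r'\<^sup>2\<bar>
      \<le> (40 * \<delta> + \<bar>r\<^sup>2 - r'\<^sup>2\<bar>) / 10000"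
    using D by argo
  have "r\<^sup>2 - r'\<^sup>2 = 8 * (kinetic_mean \<alpha> \<beta> - kinetic_mean \<alpha>' \<beta>')
      - 4 * (chord_sq \<alpha> \<beta> / r\<^sup>2 - chord_sq \<alpha>' \<beta>' / r'\<^sup>2)"
    using flight_time_root[OF assms(1)] flight_time_root[OF assms(2)]
    unfolding r_def[symmetric] r'_def[symmetric] by argo
  then have "\<bar>r\<^sup>2 - r'\<^sup>2\<bar> \<le> 10 * \<delta>" using K quot by argo
  moreover have "\<bar>r\<^sup>2 - r'\<^sup>2\<bar> = (r + r') * \<bar>r - r'\<bar>"
    using r by (simp add: abs_mult power2_eq_square square_diff_square_factored)
  moreover have "200 * \<bar>r - r'\<bar> \<le> (r + r') * \<bar>r - r'\<bar>"
    using r by (intro mult_right_mono) auto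
  ultimately show ?thesis unfolding r_def r'_def by argo
qed

lemma launch_lipschitz:
  assumes "\<bar>\<beta> - \<alpha>\<bar> \<le> 5" "\<bar>\<beta>' - \<alpha>'\<bar> \<le> 5" "\<bar>\<alpha> - \<alpha>'\<bar> \<le> \<delta>" "\<bar>\<beta> - \<beta>'\<bar> \<le> \<delta>"
  shows "\<bar>launch_u \<alpha> \<beta> - launch_u \<alpha>' \<beta>'\<bar> \<le> \<delta> / 10"
    and "\<bar>launch_v \<alpha> \<beta> - launch_v \<alpha>' \<beta>'\<bar> \<le> \<delta>"
proof -
  have r: "100 \<le> flight_time \<alpha> \<beta>" "100 \<le> flight_time \<alpha>' \<beta>'"
    using assms flight_time_ge by simp_all
  note dr = flight_time_lipschitz[OF assms]
  have quot: "\<bar>x / flight_time \<alpha> \<beta> - x' / flight_time \<alpha>' \<beta>'\<bar> \<le> \<delta> / 10"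
    if "\<bar>x'\<bar> \<le> 5" "\<bar>x - x'\<bar> \<le> 2 * \<delta>" for x x'
  proof -
    have "\<bar>x / flight_time \<alpha> \<beta> - x' / flight_time \<alpha>' \<beta>'\<bar>
        \<le> (\<bar>x - x'\<bar> + 5 / 100 * \<bar>flight_time \<alpha> \<beta> - flight_time \<alpha>' \<beta>'\<bar>) / 100"
      using r that by (intro quotient_diff_le) auto
    then show ?thesis using dr that by argo
  qed
  show "\<bar>launch_u \<alpha> \<beta> - launch_u \<alpha>' \<beta>'\<bar> \<le> \<delta> / 10"
    unfolding launch_u_def using assms by (intro quot) auto
  have "\<bar>(\<bar>sin \<beta>\<bar> - \<bar>sin \<alpha>\<bar>) / flight_time \<alpha> \<beta> - (\<bar>sin \<beta>'\<bar> - \<bar>sin \<alpha>'\<bar>) / flight_time \<alpha>' \<beta>'\<bar> \<le> \<delta> / 10"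
  proof (rule quot)
    show "\<bar>\<bar>sin \<beta>'\<bar> - \<bar>sin \<alpha>'\<bar>\<bar> \<le> 5"
      using abs_sin_lipschitz[of \<beta>' \<alpha>'] assms(2) by linarith
    have "\<bar>\<bar>sin \<alpha>\<bar> - \<bar>sin \<alpha>'\<bar>\<bar> \<le> \<delta>" "\<bar>\<bar>sin \<beta>\<bar> - \<bar>sin \<beta>'\<bar>\<bar> \<le> \<delta>"
      using abs_sin_lipschitz[of \<alpha>' \<alpha>] abs_sin_lipschitz[of \<beta>' \<beta>] assms(3,4)
      by (simp_all add: abs_minus_commute)
    then show "\<bar>(\<bar>sin \<beta>\<bar> - \<bar>sin \<alpha>\<bar>) - (\<bar>sin \<beta>'\<bar> - \<bar>sin \<alpha>'\<bar>)\<bar> \<le> 2 * \<delta>" by argo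
  qed
  then show "\<bar>launch_v \<alpha> \<beta> - launch_v \<alpha>' \<beta>'\<bar> \<le> \<delta>"
    unfolding launch_v_def using dr by argo
qed

section \<open>Collision angles by contraction\<close>

text \<open>The quotient \<open>N / W\<close> of the horizontal and the vertical velocity jump at \<open>\<beta>\<close>, for an orbit that
comes from \<open>\<alpha>\<close> and goes on to \<open>\<gamma>\<close>. The arrival velocity is minus the launch velocity of the
reversed flight, so that the jumps are sums of launch velocities.\<close>

definition jump_slope :: "real \<Rightarrow> real \<Rightarrow> real \<Rightarrow> real" where
  "jump_slope \<alpha> \<beta> \<gamma> = (launch_u \<beta> \<gamma> + launch_u \<beta> \<alpha>) / (launch_v \<beta> \<gamma> + launch_v \<beta> \<alpha>)"

lemma jump_slope_bound:
  assumes "\<bar>\<beta> - \<alpha>\<bar> \<le> 5" "\<bar>\<gamma> - \<beta>\<bar> \<le> 5"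
  shows "\<bar>jump_slope \<alpha> \<beta> \<gamma>\<bar> \<le> 1 / 4"
proof -
  have "\<bar>jump_slope \<alpha> \<beta> \<gamma>\<bar> \<le> (1 / 10) / 98"
    using launch_bounds[of \<gamma> \<beta>] launch_bounds[of \<alpha> \<beta>] assms
    unfolding jump_slope_def abs_divide by (intro frac_le) linarith+
  then show ?thesis by simp
qed

lemma jump_slope_lipschitz:
  assumes "\<bar>\<beta> - \<alpha>\<bar> \<le> 5" "\<bar>\<gamma> - \<beta>\<bar> \<le> 5" "\<bar>\<beta>' - \<alpha>'\<bar> \<le> 5" "\<bar>\<gamma>' - \<beta>'\<bar> \<le> 5"
    and "\<bar>\<alpha> - \<alpha>'\<bar> \<le> \<delta>" "\<bar>\<beta> - \<beta>'\<bar> \<le> \<delta>" "\<bar>\<gamma> - \<gamma>'\<bar> \<le> \<delta>"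
  shows "\<bar>jump_slope \<alpha> \<beta> \<gamma> - jump_slope \<alpha>' \<beta>' \<gamma>'\<bar> \<le> \<delta> / 4"
proof -
  have sw: "\<bar>\<alpha> - \<beta>\<bar> \<le> 5" "\<bar>\<alpha>' - \<beta>'\<bar> \<le> 5" using assms by (auto simp: abs_minus_commute)
  note b = launch_bounds[OF assms(2)] launch_bounds[OF sw(1)]
    launch_bounds[OF assms(4)] launch_bounds[OF sw(2)]
  note lip = launch_lipschitz[OF assms(2,4,6,7)] launch_lipschitz[OF sw assms(6,5)]
  have "\<bar>jump_slope \<alpha> \<beta> \<gamma> - jump_slope \<alpha>' \<beta>' \<gamma>'\<bar>
      \<le> (\<bar>(launch_u \<beta> \<gamma> + launch_u \<beta> \<alpha>) - (launch_u \<beta>' \<gamma>' + launch_u \<beta>' \<alpha>')\<bar>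
         + 1 / 98 * \<bar>(launch_v \<beta> \<gamma> + launch_v \<beta> \<alpha>) - (launch_v \<beta>' \<gamma>' + launch_v \<beta>' \<alpha>')\<bar>) / 98"
    unfolding jump_slope_def using b by (intro quotient_diff_le) linarith+
  then show ?thesis using lip by argo
qed

text \<open>The derivative is \<open>1 - cos z = 2 (sin (z / 2))\<^sup>2\<close>. Writing \<open>sin \<phi> = N/W\<close> as a fixed point
equation for \<open>\<phi> - sin \<phi> + N/W\<close> keeps the contraction free of the inverse sine.\<close>

lemma id_minus_sin_lipschitz:
  fixes x y :: real
  assumes "\<bar>x\<bar> \<le> 1 / 2" "\<bar>y\<bar> \<le> 1 / 2"
  shows "\<bar>(x - sin x) - (y - sin y)\<bar> \<le> \<bar>x - y\<bar> / 4"
proof -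
  have "norm ((x - sin x) - (y - sin y)) \<le> 1 / 4 * norm (x - y)"
  proof (rule field_differentiable_bound[where S = "{-1/2..1/2::real}"])
    fix z :: real assume z: "z \<in> {-1/2..1/2}"
    show "((\<lambda>z. z - sin z) has_field_derivative 1 - cos z) (at z within {-1/2..1/2})"
      by (auto intro!: derivative_eq_intros)
    have "\<bar>sin (z / 2)\<bar> \<le> \<bar>z / 2\<bar>" by (rule abs_sin_x_le_abs_x)
    then have "\<bar>sin (z / 2)\<bar> \<le> 1 / 4" using z by auto
    then have "(sin (z / 2))\<^sup>2 \<le> (1 / 4)\<^sup>2" by (metis abs_ge_zero power2_abs power_mono)
    moreover have "1 - cos z = 2 * (sin (z / 2))\<^sup>2"
      using cos_double_sin[of "z / 2"] by simp
    ultimately show "norm (1 - cos z) \<le> 1 / 4" by (simp add: power2_eq_square)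
  qed (use assms in auto)
  then show ?thesis by simp
qed

definition side_sign :: "side \<Rightarrow> real" where
  "side_sign a = (case a of L \<Rightarrow> 1 | R \<Rightarrow> - 1)"

lemma bump_distance:
  assumes "\<bar>x\<bar> \<le> 1 / 2" "\<bar>x'\<bar> \<le> 1 / 2"
  shows "\<bar>(side_sign a * (pi / 2) + x) - (side_sign b * (pi / 2) + x')\<bar> \<le> 5"
  using assms pi_less_4 pi_gt_zero unfolding side_sign_def
  by (cases a; cases b; simp only: side.case; linarith)

text \<open>A Cauchy sequence for the supremum distance converges uniformly, and continuity and boundedness
survive. For the integers as domain, whose topology is discrete, this is the space of all bounded
bi-infinite sequences.\<close>

lemma complete_bcontfun: "complete (UNIV :: ('a::topological_space \<Rightarrow>\<^sub>C 'b::complete_space) set)"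
  unfolding complete_def
proof (intro allI impI, elim conjE)
  fix f :: "nat \<Rightarrow> 'a \<Rightarrow>\<^sub>C 'b" assume f: "Cauchy f"
  have "uniformly_Cauchy_on UNIV (\<lambda>n. apply_bcontfun (f n))"
  proof (rule uniformly_Cauchy_onI)
    fix e :: real assume "e > 0"
    then obtain M where "\<And>m n. m \<ge> M \<Longrightarrow> n \<ge> M \<Longrightarrow> dist (f m) (f n) < e"
      using f unfolding Cauchy_def by meson
    then show "\<exists>M. \<forall>x\<in>UNIV. \<forall>m\<ge>M. \<forall>n\<ge>M. dist (f m x) (f n x) < e"
      using dist_fun_lt_imp_dist_val_lt by blast
  qed
  then obtain h where "uniform_limit UNIV (\<lambda>n. apply_bcontfun (f n)) h sequentially"
    using Cauchy_uniformly_convergent uniformly_convergent_on_def by blast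
  then show "\<exists>l\<in>UNIV. f \<longlonglongrightarrow> l"
    by (rule uniform_limit_bcontfunE) (auto simp: sequentially_bot)
qed

text \<open>The system of normality conditions for all collisions at once. Both summands of
\<open>(\<phi> - sin \<phi>) + N/W\<close> contribute the Lipschitz constant \<open>1/4\<close>. On the ball of radius \<open>1/2\<close> they
are at most \<open>1/8\<close> and \<open>1/4\<close>, so that the ball is mapped into itself.\<close>

lemma balanced_angles_exist:
  fixes c :: "int \<Rightarrow> side"
  obtains \<phi> :: "int \<Rightarrow> real"
  where "\<And>i. \<bar>\<phi> i\<bar> \<le> 1 / 2"
    and "\<And>i. sin (\<phi> i) = jump_slope (side_sign (c (i - 1)) * (pi / 2) + \<phi> (i - 1))
           (side_sign (c i) * (pi / 2) + \<phi> i) (side_sign (c (i + 1)) * (pi / 2) + \<phi> (i + 1))"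
proof -
  define \<theta> :: "(int \<Rightarrow>\<^sub>C real) \<Rightarrow> int \<Rightarrow> real" where
    "\<theta> f i = side_sign (c i) * (pi / 2) + apply_bcontfun f i" for f i
  define J where "J f i = jump_slope (\<theta> f (i - 1)) (\<theta> f i) (\<theta> f (i + 1))" for f i
  define B :: "(int \<Rightarrow>\<^sub>C real) set" where "B = cball 0 (1 / 2)"
  define T :: "(int \<Rightarrow>\<^sub>C real) \<Rightarrow> (int \<Rightarrow>\<^sub>C real)" where
    "T f = Bcontfun (\<lambda>i. apply_bcontfun f i - sin (apply_bcontfun f i) + J f i)" for f
  have B: "\<bar>apply_bcontfun f i\<bar> \<le> 1 / 2" if "f \<in> B" for f i
    using that norm_bounded[of f i] by (simp add: B_def)
  have gap: "\<bar>\<theta> f i - \<theta> f j\<bar> \<le> 5" if "f \<in> B" for f i j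
    unfolding \<theta>_def by (intro bump_distance B that)
  have Tbound: "\<bar>apply_bcontfun f i - sin (apply_bcontfun f i) + J f i\<bar> \<le> 1 / 2" if "f \<in> B" for f i
  proof -
    have "\<bar>J f i\<bar> \<le> 1 / 4" unfolding J_def by (intro jump_slope_bound gap that)
    moreover have "\<bar>apply_bcontfun f i - sin (apply_bcontfun f i)\<bar> \<le> \<bar>apply_bcontfun f i\<bar> / 4"
      using id_minus_sin_lipschitz[OF B[OF that, of i], of 0] by simp
    ultimately show ?thesis
      using B[OF that, of i] abs_triangle_ineq[of "apply_bcontfun f i - sin (apply_bcontfun f i)" "J f i"]
      by argo
  qed
  have T: "apply_bcontfun (T f) i = apply_bcontfun f i - sin (apply_bcontfun f i) + J f i"
    if "f \<in> B" for f i
  proof -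
    have "(\<lambda>i. apply_bcontfun f i - sin (apply_bcontfun f i) + J f i) \<in> bcontfun"
      using Tbound[OF that] by (auto intro!: bcontfun_normI[where b = "1 / 2"])
    then show ?thesis by (simp add: T_def Bcontfun_inverse)
  qed
  have "\<exists>!f\<in>B. T f = f"
  proof (rule Banach_fix[where c = "1 / 2"])
    show "complete B"
      unfolding B_def by (rule complete_closed_subset[OF closed_cball subset_UNIV complete_bcontfun])
    show "B \<noteq> {}" by (simp add: B_def)
    show "T ` B \<subseteq> B"
    proof clarify
      fix f assume "f \<in> B"
      then have "norm (T f) \<le> 1 / 2" using T Tbound by (intro norm_bound) simp
      then show "T f \<in> B" by (simp add: B_def)
    qed
    show "dist (T f) (T h) \<le> 1 / 2 * dist f h" if "f \<in> B" "h \<in> B" for f h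
    proof (rule dist_bound)
      fix i
      have d: "\<bar>apply_bcontfun f j - apply_bcontfun h j\<bar> \<le> dist f h" for j
        using dist_bounded[of f j h] by (simp add: dist_real_def)
      have "\<bar>J f i - J h i\<bar> \<le> dist f h / 4"
        unfolding J_def using d by (intro jump_slope_lipschitz gap that) (simp_all add: \<theta>_def)
      moreover have "\<bar>(apply_bcontfun f i - sin (apply_bcontfun f i))
          - (apply_bcontfun h i - sin (apply_bcontfun h i))\<bar> \<le> dist f h / 4"
        using id_minus_sin_lipschitz[OF B[OF that(1), of i] B[OF that(2), of i]] d[of i] by simp
      ultimately show "dist (apply_bcontfun (T f) i) (apply_bcontfun (T h) i) \<le> 1 / 2 * dist f h"
        unfolding T[OF that(1)] T[OF that(2)] dist_real_def by argo
    qed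
  qed auto
  then obtain f where f: "f \<in> B" "T f = f" by blast
  show ?thesis
  proof
    show "\<bar>apply_bcontfun f i\<bar> \<le> 1 / 2" for i using B[OF f(1)] .
    have "sin (apply_bcontfun f i) = J f i" for i using T[OF f(1), of i] f(2) by simp
    then show "sin (apply_bcontfun f i) = jump_slope (side_sign (c (i - 1)) * (pi / 2) + apply_bcontfun f (i - 1))
           (side_sign (c i) * (pi / 2) + apply_bcontfun f i) (side_sign (c (i + 1)) * (pi / 2) + apply_bcontfun f (i + 1))" for i
      by (simp add: J_def \<theta>_def)
  qed
qed

section \<open>Reflections and flights\<close>

text \<open>A nonzero jump along the normal that preserves the speed must be the mirror image: on a line in
normal direction there are only two points of given norm.\<close>

lemma coin_reflectI:
  assumes "sin \<theta> \<noteq> 0"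
    and jump: "u' - u = - (sin \<theta> / \<bar>sin \<theta>\<bar>) * cos \<theta> * (v' - v)"
    and speed: "u'\<^sup>2 + v'\<^sup>2 = u\<^sup>2 + v\<^sup>2" and "v' \<noteq> v"
  shows "(u', v') = coin_reflect \<theta> (u, v)"
proof -
  define \<sigma> where "\<sigma> = sin \<theta> / \<bar>sin \<theta>\<bar>"
  define k where "k = cos \<theta>"
  define d where "d = v' - v"
  have \<sigma>: "\<sigma> * \<sigma> = 1" using assms(1) by (simp add: \<sigma>_def)
  have s: "(sin \<theta>)\<^sup>2 = 1 - k\<^sup>2" by (simp add: k_def sin_squared_eq)
  have k: "1 + k\<^sup>2 > 0" by (simp add: add_pos_nonneg)
  have u': "u' = u - \<sigma> * k * d" and v': "v' = v + d"
    using jump by (simp_all add: \<sigma>_def k_def d_def)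
  \<comment> \<open>Equal speeds make the left-hand side vanish, which leaves a linear equation for the jump \<open>d\<close>.\<close>
  have "d * ((1 + k\<^sup>2) * d - (2 * \<sigma> * k * u - 2 * v))
      = (u'\<^sup>2 + v'\<^sup>2) - (u\<^sup>2 + v\<^sup>2) - (\<sigma> * \<sigma> - 1) * (k * d)\<^sup>2"
    unfolding u' v' by (simp add: algebra_simps power2_eq_square)
  then have d: "(1 + k\<^sup>2) * d = 2 * \<sigma> * k * u - 2 * v" using speed \<sigma> assms(4) by (simp add: d_def)
  have "(1 + k\<^sup>2) * u' = (1 + k\<^sup>2) * u - \<sigma> * k * ((1 + k\<^sup>2) * d)"
    unfolding u' by (simp add: algebra_simps)
  also have "\<dots> = (1 + k\<^sup>2) * u - 2 * (\<sigma> * \<sigma>) * k\<^sup>2 * u + 2 * \<sigma> * k * v"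
    unfolding d by (simp add: algebra_simps power2_eq_square)
  also have "\<dots> = (1 - k\<^sup>2) * u + 2 * k * \<sigma> * v" unfolding \<sigma> by (simp add: algebra_simps)
  finally have U: "u' = 1 / (1 + k\<^sup>2) * ((1 - k\<^sup>2) * u + 2 * k * \<sigma> * v)"
    using k by (simp add: field_simps)
  have "(1 + k\<^sup>2) * v' = 2 * k * \<sigma> * u - (1 - k\<^sup>2) * v"
    unfolding v' distrib_left d by (simp add: algebra_simps)
  then have V: "v' = 1 / (1 + k\<^sup>2) * (2 * k * \<sigma> * u - (1 - k\<^sup>2) * v)"
    using k by (simp add: field_simps)
  show ?thesis using U V unfolding coin_reflect_def s \<sigma>_def k_def by simp
qed

text \<open>Along the floor the height grows at most as fast as the angle, with rate at most \<open>5 / r\<close> in time,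
whereas in the first half of the flight the mean vertical velocity since the launch is at least about
\<open>r / 4\<close>. The second half is the first half of the reversed flight.\<close>

lemma flight_clearance:
  assumes "\<bar>\<beta> - \<alpha>\<bar> \<le> 5" "0 < s" "s < flight_time \<alpha> \<beta>"
  shows "\<bar>sin (\<alpha> + launch_u \<alpha> \<beta> * s)\<bar> < \<bar>sin \<alpha>\<bar> + launch_v \<alpha> \<beta> * s - s\<^sup>2 / 2"
proof -
  have first_half: "\<bar>sin (\<alpha> + launch_u \<alpha> \<beta> * s)\<bar> < \<bar>sin \<alpha>\<bar> + launch_v \<alpha> \<beta> * s - s\<^sup>2 / 2"
    if "\<bar>\<beta> - \<alpha>\<bar> \<le> 5" "0 < s" "s \<le> flight_time \<alpha> \<beta> / 2" for \<alpha> \<beta> s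
  proof -
    note b = launch_bounds[OF that(1)]
    define r where "r = flight_time \<alpha> \<beta>"
    have r: "100 \<le> r" using flight_time_ge[OF that(1)] by (simp add: r_def)
    have "\<bar>sin (\<alpha> + launch_u \<alpha> \<beta> * s)\<bar> \<le> \<bar>sin \<alpha>\<bar> + \<bar>launch_u \<alpha> \<beta>\<bar> * s"
      using abs_sin_lipschitz[of "\<alpha> + launch_u \<alpha> \<beta> * s" \<alpha>] that(2) by (simp add: abs_mult)
    also have "\<bar>launch_u \<alpha> \<beta>\<bar> * s < (launch_v \<alpha> \<beta> - s / 2) * s"
    proof (rule mult_strict_right_mono)
      have "\<bar>(\<bar>sin \<beta>\<bar> - \<bar>sin \<alpha>\<bar>) / r\<bar> \<le> 5 / 100"
        unfolding abs_divide using r that(1) abs_sin_lipschitz[of \<beta> \<alpha>] by (intro frac_le) auto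
      then have "launch_v \<alpha> \<beta> - r / 4 \<ge> 1"
        unfolding launch_v_def r_def[symmetric] using r by argo
      then show "\<bar>launch_u \<alpha> \<beta>\<bar> < launch_v \<alpha> \<beta> - s / 2"
        using b(1) that(3) unfolding r_def by argo
    qed (use that in simp)
    finally show ?thesis by (simp add: algebra_simps power2_eq_square)
  qed
  show ?thesis
  proof (cases "s \<le> flight_time \<alpha> \<beta> / 2")
    case True
    then show ?thesis using first_half assms by blast
  next
    case False
    define r where "r = flight_time \<alpha> \<beta>"
    have r: "r > 0" using assms by (simp add: r_def)
    have u: "launch_u \<beta> \<alpha> * r = \<alpha> - \<beta>" "launch_u \<alpha> \<beta> = - launch_u \<beta> \<alpha>"
      using r unfolding launch_u_def flight_time_commute[of \<beta>] r_def[symmetric]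
      by (simp_all add: field_simps)
    have v: "launch_v \<beta> \<alpha> * r = \<bar>sin \<alpha>\<bar> - \<bar>sin \<beta>\<bar> + r\<^sup>2 / 2" "launch_v \<alpha> \<beta> = r - launch_v \<beta> \<alpha>"
      using r unfolding launch_v_def flight_time_commute[of \<beta>] r_def[symmetric]
      by (simp_all add: field_simps power2_eq_square)
    have "\<bar>sin (\<beta> + launch_u \<beta> \<alpha> * (r - s))\<bar>
        < \<bar>sin \<beta>\<bar> + launch_v \<beta> \<alpha> * (r - s) - (r - s)\<^sup>2 / 2"
      using assms False unfolding r_def
      by (intro first_half) (auto simp: abs_minus_commute flight_time_commute[of \<beta>])
    also have "\<beta> + launch_u \<beta> \<alpha> * (r - s) = \<alpha> + launch_u \<alpha> \<beta> * s"
      unfolding right_diff_distrib u by simp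
    also have "\<bar>sin \<beta>\<bar> + launch_v \<beta> \<alpha> * (r - s) - (r - s)\<^sup>2 / 2
        = \<bar>sin \<alpha>\<bar> + launch_v \<alpha> \<beta> * s - s\<^sup>2 / 2"
      unfolding right_diff_distrib v power2_diff by (simp add: field_simps power2_eq_square)
    finally show ?thesis .
  qed
qed

section \<open>Gluing flights along the time axis\<close>

text \<open>The lower bound on the durations excludes an accumulation of collision times.\<close>

lemma partition_of_line_exists:
  fixes \<tau> :: "int \<Rightarrow> real"
  assumes "0 < \<delta>" and "\<And>i. \<delta> \<le> \<tau> i"
  obtains t where "strict_mono t" "\<And>i. t (i + 1) = t i + \<tau> i" "\<And>x. \<exists>i. t i \<le> x \<and> x < t (i + 1)"
proof -
  \<comment> \<open>One of the two sums is empty, so that this is a signed sum from \<open>0\<close> to \<open>i\<close>.\<close>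
  define t where "t i = (\<Sum>j\<in>{0..<i}. \<tau> j) - (\<Sum>j\<in>{i..<0}. \<tau> j)" for i
  have step: "t (i + 1) = t i + \<tau> i" for i
  proof (cases "0 \<le> i")
    case True
    then have "{0..<i + 1} = insert i {0..<i}" by auto
    then show ?thesis using True by (simp add: t_def)
  next
    case False
    then have "{i..<0} = insert i {i + 1..<0}" by auto
    then show ?thesis using False by (simp add: t_def)
  qed
  have grow: "t i + \<delta> * real n \<le> t (i + int n)" for i n
  proof (induction n)
    case (Suc n)
    have "t (i + int (Suc n)) = t (i + int n) + \<tau> (i + int n)"
      using step[of "i + int n"] by (simp add: algebra_simps)
    then show ?case using Suc assms(2)[of "i + int n"] by (simp add: algebra_simps)
  qed simp
  have mono: "strict_mono t"
  proof (rule strict_monoI)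
    fix i j :: int assume "i < j"
    then obtain n where n: "j = i + int n" "n > 0" by (metis zless_iff_Suc_zadd zero_less_Suc)
    then show "t i < t j" using grow[of i n] assms(1) by (smt (verit) mult_pos_pos of_nat_0_less_iff)
  qed
  have "\<exists>i. t i \<le> x \<and> x < t (i + 1)" for x
  proof -
    have t0: "t 0 = 0" by (simp add: t_def)
    obtain a where a: "\<bar>x\<bar> < \<delta> * real a" using reals_Archimedean3[OF assms(1)] by (metis mult.commute)
    have lo: "t (- int a) \<le> x" using grow[of "- int a" a] t0 a by simp
    have "x < t (- int a + int (2 * a))" using grow[of 0 a] t0 a by simp
    then have ex: "\<exists>n. x < t (- int a + int n)" by blast
    define n where "n = (LEAST n. x < t (- int a + int n))"
    have n: "x < t (- int a + int n)" unfolding n_def using ex by (rule LeastI_ex)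
    then have "n \<noteq> 0" using lo by (cases n) auto
    then obtain k where k: "n = Suc k" using not0_implies_Suc by blast
    have "\<not> x < t (- int a + int k)" using not_less_Least[of k "\<lambda>n. x < t (- int a + int n)"] k unfolding n_def by simp
    then show ?thesis using n k by (intro exI[of _ "- int a + int k"]) (simp add: algebra_simps)
  qed
  then show ?thesis using that[OF mono step] by blast
qed

lemma glue_exists:
  fixes t :: "int \<Rightarrow> real" and f :: "int \<Rightarrow> real \<Rightarrow> real"
  assumes "strict_mono t" and cover: "\<And>x. \<exists>i. t i \<le> x \<and> x < t (i + 1)"
    and match: "\<And>i. f i (t (i + 1)) = f (i + 1) (t (i + 1))"
  obtains F where "\<forall>i. \<forall>x\<in>{t i..t (i + 1)}. F x = f i x"
proof -
  define idx where "idx x = (SOME i. t i \<le> x \<and> x < t (i + 1))" for x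
  have idx: "t (idx x) \<le> x" "x < t (idx x + 1)" for x
    using someI_ex[OF cover[of x]] by (auto simp: idx_def)
  have uniq: "idx x = i" if "t i \<le> x" "x < t (i + 1)" for x i
  proof -
    have "t i < t (idx x + 1)" "t (idx x) < t (i + 1)" using that idx[of x] by linarith+
    then show ?thesis using strict_mono_less[OF assms(1)] by force
  qed
  have "f (idx x) x = f i x" if "t i \<le> x" "x \<le> t (i + 1)" for i x
  proof (cases "x = t (i + 1)")
    case True
    have "idx x = i + 1" using True strict_monoD[OF assms(1)] by (intro uniq) auto
    then show ?thesis using True match by simp
  next
    case False
    then show ?thesis using uniq[of i x] that by simp
  qed
  then show ?thesis by (intro that[of "\<lambda>x. f (idx x) x"]) simp
qed

text \<open>At a knot the glued function agrees on one side with the piece that ends there and on the other side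
with the piece that starts there, which yields the velocities before and after a collision.\<close>

lemma glued_derivatives:
  fixes t :: "int \<Rightarrow> real" and f f' :: "int \<Rightarrow> real \<Rightarrow> real"
  assumes "strict_mono t"
    and F: "\<forall>i. \<forall>x\<in>{t i..t (i + 1)}. F x = f i x"
    and f': "\<And>i x. (f i has_real_derivative f' i x) (at x)"
  shows glued_derivative: "t i < x \<Longrightarrow> x < t (i + 1) \<Longrightarrow> (F has_real_derivative f' i x) (at x)"
    and glued_right_derivative: "(F has_real_derivative f' i (t i)) (at_right (t i))"
    and glued_left_derivative: "(F has_real_derivative f' (i - 1) (t i)) (at_left (t i))"
proof -
  have less: "t j < t (j + 1)" for j using strict_monoD[OF assms(1)] by simp
  show "(F has_real_derivative f' i x) (at x)" if "t i < x" "x < t (i + 1)"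
    by (rule has_field_derivative_transform_within_open[OF f', of "{t i<..<t (i + 1)}"])
      (use that F[rule_format, of _ i] in auto)
  have one_sided: "(F has_real_derivative f' j a) (at a within S)"
    if "a \<in> {t j..t (j + 1)}" "eventually (\<lambda>x. x \<in> {t j..t (j + 1)}) (at a within S)" for j a S
  proof -
    have "eventually (\<lambda>x. F x = f j x) (at a within S)"
      using that(2) by eventually_elim (rule F[rule_format])
    then have "(F has_real_derivative f' j a) (at a within S)
        \<longleftrightarrow> (f j has_real_derivative f' j a) (at a within S)"
      using F[rule_format, of a j] that(1) by (intro has_field_derivative_cong_eventually) auto
    then show ?thesis using has_field_derivative_at_within[OF f'] by blast
  qed
  show "(F has_real_derivative f' i (t i)) (at_right (t i))"
    using less[of i] eventually_at_right_real[OF less[of i]]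
    by (intro one_sided) (auto elim: eventually_mono)
  show "(F has_real_derivative f' (i - 1) (t i)) (at_left (t i))"
    using less[of "i - 1"] eventually_at_left_real[of "t (i - 1)" "t i"]
    by (intro one_sided) (auto elim: eventually_mono)
qed

lemma glued_continuous:
  fixes t :: "int \<Rightarrow> real" and f f' :: "int \<Rightarrow> real \<Rightarrow> real"
  assumes "strict_mono t" and cover: "\<And>x. \<exists>i. t i \<le> x \<and> x < t (i + 1)"
    and F: "\<forall>i. \<forall>x\<in>{t i..t (i + 1)}. F x = f i x"
    and f': "\<And>i x. (f i has_real_derivative f' i x) (at x)"
  shows "continuous_on UNIV F"
  unfolding continuous_on_eq_continuous_at[OF open_UNIV]
proof
  fix x
  note der = glued_derivatives[where F = F, OF assms(1) F f']
  obtain i where i: "t i \<le> x" "x < t (i + 1)" using cover by blast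
  show "isCont F x"
  proof (cases "x = t i")
    case True
    then show ?thesis
      using der(2,3)[of i] DERIV_continuous unfolding continuous_at_split by blast
  next
    case False
    then show ?thesis using der(1)[of i x] i DERIV_isCont by auto
  qed
qed

section \<open>Realization of label sequences\<close>

theorem theorem1p1:
  fixes mL mR l g :: real and c :: "int \<Rightarrow> side"
  assumes "mL > 0" and "mR > 0" and "mL = mR" and "l > 0" and "g > 0"
  shows "\<exists>(\<theta> :: real \<Rightarrow> real) (Y :: real \<Rightarrow> real) (t :: int \<Rightarrow> real).
           coin_motion mL mR l g \<theta> Y \<and>
           strict_mono t \<and> range t = collision_times l \<theta> Y \<and>
           (\<forall>i. collision_label l \<theta> Y (t i) (c i))"
proof -
  obtain \<phi> where \<phi>: "\<And>i. \<bar>\<phi> i\<bar> \<le> 1 / 2"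
    and bal: "\<And>i. sin (\<phi> i) = jump_slope (side_sign (c (i - 1)) * (pi / 2) + \<phi> (i - 1))
           (side_sign (c i) * (pi / 2) + \<phi> i) (side_sign (c (i + 1)) * (pi / 2) + \<phi> (i + 1))"
    by (rule balanced_angles_exist[of c]) blast
  define A where "A i = side_sign (c i) * (pi / 2) + \<phi> i" for i
  have gap: "\<bar>A i - A j\<bar> \<le> 5" for i j
    unfolding A_def by (intro bump_distance \<phi>)
  have \<phi>pi: "- (pi / 2) < \<phi> i" "\<phi> i < pi / 2" for i using \<phi>[of i] pi_gt3 by auto
  have cospos: "cos (\<phi> i) > 0" for i using \<phi>pi by (intro cos_gt_zero_pi) auto
  have sinA: "sin (A i) = side_sign (c i) * cos (\<phi> i)"
    and cosA: "cos (A i) = - side_sign (c i) * sin (\<phi> i)" for i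
    unfolding A_def side_sign_def by (cases "c i"; simp only: side.case sin_add cos_add; simp)+
  have abs_sinA: "\<bar>sin (A i)\<bar> = side_sign (c i) * sin (A i)" for i
    using cospos[of i] unfolding sinA by (cases "c i") (auto simp: side_sign_def)
  have sinA0: "sin (A i) \<noteq> 0" for i
    using cospos[of i] unfolding sinA by (cases "c i") (auto simp: side_sign_def)
  \<comment> \<open>Measured from its tip, each bump is the graph of the cosine, with slope \<open>- sin\<close>.\<close>
  have slopeA: "sin (A i) / \<bar>sin (A i)\<bar> * cos (A i) = - sin (\<phi> i)" for i
    using cospos[of i] unfolding abs_sinA sinA cosA by (cases "c i") (auto simp: side_sign_def)

  \<comment> \<open>\<open>G\<close> is the acceleration in the rescaled height. The factor \<open>w\<close> turns time into the time
    for unit gravity; velocities are multiplied by it.\<close>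
  define G where "G = g * 2 / l"
  have G: "G > 0" using assms by (simp add: G_def)
  define w where "w = sqrt G"
  have w: "w > 0" "w * w = G" using G by (auto simp: w_def)
  define r where "r i = flight_time (A i) (A (i + 1))" for i
  have r: "100 \<le> r i" for i unfolding r_def by (intro flight_time_ge gap)
  define U where "U i = launch_u (A i) (A (i + 1))" for i
  define V where "V i = launch_v (A i) (A (i + 1))" for i
  \<comment> \<open>By time reversal, minus the velocity right before collision \<open>i\<close>.\<close>
  define U' where "U' i = launch_u (A i) (A (i - 1))" for i
  define V' where "V' i = launch_v (A i) (A (i - 1))" for i
  have Ur: "U i * r i = A (i + 1) - A i" and Vr: "V i * r i = \<bar>sin (A (i + 1))\<bar> - \<bar>sin (A i)\<bar> + (r i)\<^sup>2 / 2"
    and U': "U' (i + 1) = - U i" and V': "V' (i + 1) = r i - V i" for i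
  proof -
    have time: "flight_time (A i) (A (i + 1)) = r i" "flight_time (A (i + 1)) (A i) = r i"
      by (simp_all add: r_def flight_time_commute)
    have "r i \<noteq> 0" using r[of i] by simp
    then show "U i * r i = A (i + 1) - A i"
      "V i * r i = \<bar>sin (A (i + 1))\<bar> - \<bar>sin (A i)\<bar> + (r i)\<^sup>2 / 2"
      "U' (i + 1) = - U i" "V' (i + 1) = r i - V i"
      unfolding U_def V_def U'_def V'_def launch_u_def launch_v_def add_diff_cancel_right' time
      by (simp_all add: field_simps power2_eq_square)
  qed

  have "100 / w \<le> r i / w" for i using r w by (simp add: divide_right_mono)
  then obtain t where mono: "strict_mono t" and step: "\<And>i. t (i + 1) = t i + r i / w"
    and cover: "\<And>x. \<exists>i. t i \<le> x \<and> x < t (i + 1)"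
    using partition_of_line_exists[of "100 / w" "\<lambda>i. r i / w"] w by auto
  have wstep: "w * (t (i + 1) - t i) = r i" for i using w by (simp add: step)

  \<comment> \<open>Angle and rescaled height on the flight from collision \<open>i\<close> to collision \<open>i + 1\<close>.\<close>
  define f where "f i x = A i + U i * (w * (x - t i))" for i x
  define h where "h i x = \<bar>sin (A i)\<bar> + V i * (w * (x - t i)) - (w * (x - t i))\<^sup>2 / 2" for i x
  have df: "(f i has_real_derivative w * U i) (at x)" for i x
    unfolding f_def by (auto intro!: derivative_eq_intros)
  have dh: "(h i has_real_derivative w * (V i - w * (x - t i))) (at x)" for i x
    unfolding h_def by (auto intro!: derivative_eq_intros simp: field_simps)
  have f0: "f i (t i) = A i" and h0: "h i (t i) = \<bar>sin (A i)\<bar>" for i by (simp_all add: f_def h_def)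
  have "f i (t (i + 1)) = f (i + 1) (t (i + 1))" for i
    unfolding f0 by (simp add: f_def wstep Ur)
  then obtain \<theta> where \<theta>: "\<forall>i. \<forall>x\<in>{t i..t (i + 1)}. \<theta> x = f i x"
    using glue_exists[OF mono cover, of f] by blast
  have "h i (t (i + 1)) = h (i + 1) (t (i + 1))" for i
    unfolding h0 by (simp add: h_def wstep Vr)
  then obtain y where y: "\<forall>i. \<forall>x\<in>{t i..t (i + 1)}. y x = h i x"
    using glue_exists[OF mono cover, of h] by blast
  note d\<theta> = glued_derivatives[where F = \<theta>, OF mono \<theta> df]
  note dy = glued_derivatives[where F = y, OF mono y dh]
  have less: "t i < t (i + 1)" for i using mono by (simp add: strict_mono_def)
  have \<theta>t: "\<theta> (t i) = A i" and yt: "y (t i) = \<bar>sin (A i)\<bar>" for i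
    using \<theta>[rule_format, of "t i" i] y[rule_format, of "t i" i] less[of i] f0 h0 by auto

  have clear: "\<bar>sin (\<theta> x)\<bar> < y x" if "t i < x" "x < t (i + 1)" for i x
  proof -
    have s: "0 < w * (x - t i)" "w * (x - t i) < flight_time (A i) (A (i + 1))"
      using that w wstep[of i] mult_strict_left_mono[of "x - t i" "t (i + 1) - t i" w]
      by (auto simp: r_def)
    show ?thesis
      using flight_clearance[OF gap s] that \<theta>[rule_format, of x i] y[rule_format, of x i]
      by (simp add: f_def h_def U_def V_def)
  qed
  have above: "\<bar>sin (\<theta> x)\<bar> \<le> y x" for x
  proof -
    obtain i where "t i \<le> x" "x < t (i + 1)" using cover by blast
    then show ?thesis using clear[of i x] \<theta>t[of i] yt[of i] by (cases "x = t i") auto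
  qed

  define Y where "Y x = l / 2 * y x" for x
  have heightL: "coin_height l L (\<theta> x) (Y x) = l / 2 * (y x - sin (\<theta> x))"
    and heightR: "coin_height l R (\<theta> x) (Y x) = l / 2 * (y x + sin (\<theta> x))" for x
    by (simp_all add: coin_height_def Y_def right_diff_distrib distrib_left)
  have coll: "x \<in> collision_times l \<theta> Y \<longleftrightarrow> y x = \<bar>sin (\<theta> x)\<bar>" for x
  proof
    assume "x \<in> collision_times l \<theta> Y"
    then obtain a where "coin_height l a (\<theta> x) (Y x) = 0" by (auto simp: collision_times_def)
    then have "y x = sin (\<theta> x) \<or> y x = - sin (\<theta> x)"
      using assms(4) heightL[of x] heightR[of x] by (cases a) auto
    then show "y x = \<bar>sin (\<theta> x)\<bar>" using above[of x] by linarith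
  next
    assume "y x = \<bar>sin (\<theta> x)\<bar>"
    then have "coin_height l L (\<theta> x) (Y x) = 0 \<or> coin_height l R (\<theta> x) (Y x) = 0"
      unfolding heightL heightR by (cases "0 \<le> sin (\<theta> x)") simp_all
    then show "x \<in> collision_times l \<theta> Y" by (auto simp: collision_times_def)
  qed
  have range_t: "range t = collision_times l \<theta> Y"
  proof (intro equalityI subsetI)
    fix x assume "x \<in> range t"
    then show "x \<in> collision_times l \<theta> Y" by (auto simp: coll \<theta>t yt)
  next
    fix x assume x: "x \<in> collision_times l \<theta> Y"
    obtain i where i: "t i \<le> x" "x < t (i + 1)" using cover by blast
    then have "x = t i" using clear[of i x] x coll[of x] by force
    then show "x \<in> range t" by simp
  qed
  have label: "collision_label l \<theta> Y (t i) (c i)" for i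
  proof (cases "c i")
    case L
    then show ?thesis
      using \<phi>pi[of i] abs_sinA[of i] unfolding collision_label_def L side.case heightL
      by (auto simp: L \<theta>t yt A_def side_sign_def intro!: exI[of _ "0::int"])
  next
    case R
    then show ?thesis
      using \<phi>pi[of i] abs_sinA[of i] unfolding collision_label_def R side.case heightR
      by (auto simp: R \<theta>t yt A_def side_sign_def intro!: exI[of _ "0::int"])
  qed

  have reflect: "(w * U i, w * V i) = coin_reflect (A i) (- (w * U' i), - (w * V' i))" for i
  proof (rule coin_reflectI[OF sinA0])
    have VV: "V i + V' i > 0"
      using launch_bounds(2)[of "A (i + 1)" "A i"] launch_bounds(2)[of "A (i - 1)" "A i"] gap
      by (simp add: V_def V'_def add_pos_pos)
    then show "w * V i \<noteq> - (w * V' i)" using w by (smt (verit) distrib_left mult_pos_pos)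
    have "sin (\<phi> i) = (U i + U' i) / (V i + V' i)"
      using bal[of i] unfolding jump_slope_def U_def U'_def V_def V'_def A_def .
    then have "U i + U' i = sin (\<phi> i) * (V i + V' i)" using VV by simp
    then have "w * (U i + U' i) = - (sin (A i) / \<bar>sin (A i)\<bar> * cos (A i)) * (w * (V i + V' i))"
      unfolding slopeA by simp
    then show "w * U i - - (w * U' i) = - (sin (A i) / \<bar>sin (A i)\<bar>) * cos (A i) * (w * V i - - (w * V' i))"
      by (simp add: distrib_left)
    have "(U i)\<^sup>2 + (V i)\<^sup>2 = (U' i)\<^sup>2 + (V' i)\<^sup>2"
      unfolding U_def V_def U'_def V'_def by (simp add: launch_energy gap)
    then have "w\<^sup>2 * ((U i)\<^sup>2 + (V i)\<^sup>2) = w\<^sup>2 * ((U' i)\<^sup>2 + (V' i)\<^sup>2)" by simp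
    then show "(w * U i)\<^sup>2 + (w * V i)\<^sup>2 = (- (w * U' i))\<^sup>2 + (- (w * V' i))\<^sup>2"
      by (simp add: power_mult_distrib distrib_left)
  qed

  define m where "m = mL + mR"
  have m: "m > 0" using assms by (simp add: m_def)
  have inertia: "coin_inertia mL mR l = 1 / 4 * m * l\<^sup>2"
    by (simp add: coin_inertia_def m_def)
  have "coin_inertia mL mR l / m = (l / 2)\<^sup>2"
    using m unfolding inertia by (simp add: power2_eq_square)
  then have unit: "sqrt (coin_inertia mL mR l / m) = l / 2"
    using assms by (simp only: real_sqrt_abs)
  have "m / coin_inertia mL mR l = (2 / l)\<^sup>2"
    using m assms unfolding inertia by (simp add: power2_eq_square)
  then have accel: "g * sqrt (m / coin_inertia mL mR l) = G"
    using assms by (simp only: real_sqrt_abs G_def) (simp add: abs_divide)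
  have Yy: "(\<lambda>x. Y x / (l / 2)) = y" using assms by (simp add: Y_def fun_eq_iff)

  have free: "\<theta> differentiable (at x) \<and> y differentiable (at x) \<and>
      (deriv \<theta> has_real_derivative 0) (at x) \<and> (deriv y has_real_derivative - G) (at x)"
    if "x \<notin> collision_times l \<theta> Y" for x
  proof -
    obtain i where i: "t i \<le> x" "x < t (i + 1)" using cover by blast
    then have i': "t i < x" using that range_t by (cases "x = t i") auto
    have "(deriv \<theta> has_real_derivative 0) (at x)"
    proof (rule has_field_derivative_transform_within_open[of "\<lambda>_. w * U i" 0 x "{t i<..<t (i + 1)}"])
      show "w * U i = deriv \<theta> s" if "s \<in> {t i<..<t (i + 1)}" for s
        using d\<theta>(1)[of i s] that by (simp add: DERIV_imp_deriv)
    qed (use i i' in auto)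
    moreover have "(deriv y has_real_derivative - G) (at x)"
    proof (rule has_field_derivative_transform_within_open
        [of "\<lambda>s. w * (V i - w * (s - t i))" "- G" x "{t i<..<t (i + 1)}"])
      show "((\<lambda>s. w * (V i - w * (s - t i))) has_real_derivative - G) (at x)"
        using w by (auto intro!: derivative_eq_intros)
      show "w * (V i - w * (s - t i)) = deriv y s" if "s \<in> {t i<..<t (i + 1)}" for s
        using dy(1)[of i s] that by (simp add: DERIV_imp_deriv)
    qed (use i i' in auto)
    moreover have "\<theta> differentiable (at x)" "y differentiable (at x)"
      using d\<theta>(1)[OF i' i(2)] dy(1)[OF i' i(2)] real_differentiable_def by blast+
    ultimately show ?thesis by blast
  qed
  have bounce: "\<exists>u v u' v'.
      (\<theta> has_real_derivative u) (at_left x) \<and> (y has_real_derivative v) (at_left x) \<and>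
      (\<theta> has_real_derivative u') (at_right x) \<and> (y has_real_derivative v') (at_right x) \<and>
      (u', v') = coin_reflect (\<theta> x) (u, v)"
    if hit: "x \<in> collision_times l \<theta> Y" for x
  proof -
    obtain i where x: "x = t i" using hit range_t by blast
    have landing: "w * (t i - t (i - 1)) = r (i - 1)" "U (i - 1) = - U' i"
        "V (i - 1) - r (i - 1) = - V' i"
      using wstep[of "i - 1"] U'[of "i - 1"] V'[of "i - 1"] by simp_all
    note before = d\<theta>(3)[of i, unfolded landing mult_minus_right]
      dy(3)[of i, unfolded landing mult_minus_right]
    have "(\<theta> has_real_derivative - (w * U' i)) (at_left x)"
      "(y has_real_derivative - (w * V' i)) (at_left x)"
      "(\<theta> has_real_derivative w * U i) (at_right x)" "(y has_real_derivative w * V i) (at_right x)"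
      using before d\<theta>(2)[of i] dy(2)[of i] unfolding x by simp_all
    then show ?thesis using reflect[of i] unfolding x \<theta>t by blast
  qed
  have "coin_motion mL mR l g \<theta> Y"
    unfolding coin_motion_def Let_def m_def[symmetric] unit accel Yy mult_minus_left
  proof (intro conjI allI impI)
    show "continuous_on UNIV \<theta>" by (rule glued_continuous[OF mono cover \<theta> df])
    have "continuous_on UNIV y" by (rule glued_continuous[OF mono cover y dh])
    then show "continuous_on UNIV Y" unfolding Y_def by (intro continuous_intros)
    show "0 \<le> coin_height l a (\<theta> x) (Y x)" for a x
      using above[of x] assms(4) by (cases a) (auto simp: heightL heightR)
  qed (use free bounce in auto)
  then show ?thesis using mono range_t label by blast
qed

end
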